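(* There exist infinitely many vertex-transitive graphs $X$ that are not Cayley graphs (of any group) and have Hamilton compression $\kappa(X)=1$.
   Context: Graphs are finite, simple and undirected, and "infinitely many" is understood up to isomorphism. Hamilton compression: let $X$ be a graph of order $n$. A Hamilton cycle $C=v_0,v_1,\ldots,v_{n-1},v_0$ in $X$ is $k$-symmetric (where $k$ is a positive divisor of $n$) if there exists an automorphism $\alpha$ of $X$ such that $\alpha(v_i)=v_{i+n/k}$ for each $i\in\mathbb{Z}_n$. The compression factor $\kappa(X,C)$ is the maximum $k$ for which $C$ is $k$-symmetric. The Hamilton compression is $\kappa(X)=\max\{\kappa(X,C)\mid C \text{ is a Hamilton cycle in } X\}$, and $\kappa(X)=0$ if $X$ has no Hamilton cycle. *)

theory Defs
  imports
    "HOL-Algebra.Group"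
    "Graph_Theory.Pair_Digraph"
    "Graph_Theory.Digraph_Isomorphism"
begin

text \<open>
  A finite simple undirected graph is a \<^locale>\<open>pair_graph\<close>: a finite, loopless, symmetric set of
  arcs on a finite vertex set, so that an edge \<open>uv\<close> is present as the two arcs \<open>(u,v)\<close> and \<open>(v,u)\<close>.
  Isomorphism is \<^const>\<open>digraph_iso\<close>, applied through the embedding \<^const>\<open>with_proj\<close>.
\<close>

text \<open>
  The values of \<open>\<alpha>\<close> outside the vertex set are irrelevant.
\<close>

definition automorphism :: "'a pair_pre_digraph \<Rightarrow> ('a \<Rightarrow> 'a) \<Rightarrow> bool" where
  "automorphism X \<alpha> \<longleftrightarrow>
     (\<exists>h. pre_digraph.digraph_isomorphism (with_proj X) h \<and>
          app_iso h (with_proj X) = with_proj X \<and> iso_verts h = \<alpha>)"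

definition vertex_transitive :: "'a pair_pre_digraph \<Rightarrow> bool" where
  "vertex_transitive X \<longleftrightarrow>
     (\<forall>u \<in> pverts X. \<forall>v \<in> pverts X. \<exists>\<alpha>. automorphism X \<alpha> \<and> \<alpha> u = v)"

definition cayley_graph :: "('a, 'b) monoid_scheme \<Rightarrow> 'a set \<Rightarrow> 'a pair_pre_digraph" where
  "cayley_graph G S =
     \<lparr>pverts = carrier G, parcs = {(g, g \<otimes>\<^bsub>G\<^esub> s) | g s. g \<in> carrier G \<and> s \<in> S}\<rparr>"

text \<open>
  The connection set is not required to generate the group. The group is taken on the vertex type
  of \<open>X\<close>, which loses no generality; see \<open>is_cayley_graphI\<close> below.
\<close>

definition is_cayley_graph :: "'a pair_pre_digraph \<Rightarrow> bool" where
  "is_cayley_graph X \<longleftrightarrow>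
     (\<exists>(G :: 'a monoid) S. group G \<and> S \<subseteq> carrier G - {\<one>\<^bsub>G\<^esub>} \<and> (\<forall>s \<in> S. inv\<^bsub>G\<^esub> s \<in> S) \<and>
        digraph_iso (with_proj X) (with_proj (cayley_graph G S)))"

text \<open>
  A Hamilton cycle \<open>v\<^sub>0, v\<^sub>1, \<dots>, v\<^bsub>n-1\<^esub>, v\<^sub>0\<close> is the list \<open>[v\<^sub>0, \<dots>, v\<^bsub>n-1\<^esub>]\<close> with indices read
  modulo \<open>n\<close>. The condition \<open>n \<ge> 3\<close> excludes walking back and forth along a single edge.
\<close>

definition hamilton_cycle :: "'a pair_pre_digraph \<Rightarrow> 'a list \<Rightarrow> bool" where
  "hamilton_cycle X C \<longleftrightarrow>
     length C \<ge> 3 \<and> distinct C \<and> set C = pverts X \<and>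
     (\<forall>i < length C. (C ! i, C ! ((i + 1) mod length C)) \<in> parcs X)"

definition symmetric_cycle :: "'a pair_pre_digraph \<Rightarrow> 'a list \<Rightarrow> nat \<Rightarrow> bool" where
  "symmetric_cycle X C k \<longleftrightarrow>
     k > 0 \<and> k dvd length C \<and>
     (\<exists>\<alpha>. automorphism X \<alpha> \<and>
        (\<forall>i < length C. \<alpha> (C ! i) = C ! ((i + length C div k) mod length C)))"

definition compression_factor :: "'a pair_pre_digraph \<Rightarrow> 'a list \<Rightarrow> nat" where
  "compression_factor X C = Max {k. symmetric_cycle X C k}"

definition hamilton_compression :: "'a pair_pre_digraph \<Rightarrow> nat" where
  "hamilton_compression X =
     (if \<exists>C. hamilton_cycle X C then Max {compression_factor X C | C. hamilton_cycle X C} else 0)"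


lemma digraph_isomorphism_to_pair_iff:
  assumes "pair_wf_digraph X"
  shows "(\<exists>h. pre_digraph.digraph_isomorphism (with_proj X) h \<and>
              with_proj Y = app_iso h (with_proj X) \<and> iso_verts h = f) \<longleftrightarrow>
         bij_betw f (pverts X) (pverts Y) \<and> map_prod f f ` parcs X = parcs Y"
proof
  assume "\<exists>h. pre_digraph.digraph_isomorphism (with_proj X) h \<and>
              with_proj Y = app_iso h (with_proj X) \<and> iso_verts h = f"
  then obtain h where h: "pre_digraph.digraph_isomorphism (with_proj X) h"
      "with_proj Y = app_iso h (with_proj X)" "iso_verts h = f" by blast
  from h(2) have Y: "pverts Y = f ` pverts X" "parcs Y = iso_arcs h ` parcs X"
      "iso_tail h = fst" "iso_head h = snd"
    using h(3) by (auto simp: with_proj_def app_iso_def)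
  from h(1) have inj: "inj_on f (pverts X)"
    and ends: "\<And>a. a \<in> parcs X \<Longrightarrow> f (fst a) = fst (iso_arcs h a) \<and> f (snd a) = snd (iso_arcs h a)"
    using h(3) Y(3,4) by (auto simp: pre_digraph.digraph_isomorphism_def)
  have "iso_arcs h a = map_prod f f a" if "a \<in> parcs X" for a
    using ends[OF that] by (cases a; cases "iso_arcs h a") auto
  then show "bij_betw f (pverts X) (pverts Y) \<and> map_prod f f ` parcs X = parcs Y"
    using inj Y by (auto simp: bij_betw_def)
next
  assume f: "bij_betw f (pverts X) (pverts Y) \<and> map_prod f f ` parcs X = parcs Y"
  interpret pair_wf_digraph X by (fact assms)
  have inj: "inj_on f (pverts X)" using f by (simp add: bij_betw_def)
  have "inj_on (map_prod f f) (pverts X \<times> pverts X)"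
    using map_prod_inj_on[OF inj inj] .
  then have inj': "inj_on (map_prod f f) (parcs X)"
    by (rule inj_on_subset) (use in_arcsD1 in_arcsD2 in auto)
  let ?h = "\<lparr>iso_verts = f, iso_arcs = map_prod f f, iso_head = snd, iso_tail = fst\<rparr>"
  have "pre_digraph.digraph_isomorphism (with_proj X) ?h"
    using inj inj' wf_digraph_axioms by (auto simp: pre_digraph.digraph_isomorphism_def)
  moreover have "with_proj Y = app_iso ?h (with_proj X)"
    using f by (auto simp: with_proj_def app_iso_def bij_betw_def)
  ultimately show "\<exists>h. pre_digraph.digraph_isomorphism (with_proj X) h \<and>
              with_proj Y = app_iso h (with_proj X) \<and> iso_verts h = f"
    by (intro exI[of _ ?h]) simp
qed

lemma digraph_iso_pair_iff:
  assumes "pair_wf_digraph X"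
  shows "digraph_iso (with_proj X) (with_proj Y) \<longleftrightarrow>
         (\<exists>f. bij_betw f (pverts X) (pverts Y) \<and> map_prod f f ` parcs X = parcs Y)"
  using digraph_isomorphism_to_pair_iff[OF assms, of Y] unfolding digraph_iso_def by metis

lemma automorphism_iff:
  assumes "pair_wf_digraph X"
  shows "automorphism X \<alpha> \<longleftrightarrow>
         bij_betw \<alpha> (pverts X) (pverts X) \<and> map_prod \<alpha> \<alpha> ` parcs X = parcs X"
  using digraph_isomorphism_to_pair_iff[OF assms, of X \<alpha>] unfolding automorphism_def by metis

lemma pair_wf_digraph_cayley_graph:
  assumes "group G" "S \<subseteq> carrier G"
  shows "pair_wf_digraph (cayley_graph G S)"
proof -
  interpret group G by fact
  show ?thesis using assms(2) by unfold_locales (auto simp: cayley_graph_def)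
qed

lemma is_cayley_graphI:
  fixes X :: "'a pair_pre_digraph"
  assumes "pair_wf_digraph X"
    and G: "group (G :: 'b monoid)" and S: "S \<subseteq> carrier G - {\<one>\<^bsub>G\<^esub>}" "\<forall>s \<in> S. inv\<^bsub>G\<^esub> s \<in> S"
    and iso: "digraph_iso (with_proj X) (with_proj (cayley_graph G S))"
  shows "is_cayley_graph X"
proof -
  interpret G: group G by fact
  obtain f where f: "bij_betw f (pverts X) (carrier G)"
      "map_prod f f ` parcs X = parcs (cayley_graph G S)"
    using iso unfolding digraph_iso_pair_iff[OF assms(1)] by (auto simp: cayley_graph_def)
  define g where "g = the_inv_into (pverts X) f"
  have g: "bij_betw g (carrier G) (pverts X)"
    unfolding g_def by (rule bij_betw_the_inv_into[OF f(1)])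
  have fg: "f (g y) = y" if "y \<in> carrier G" for y
    using f(1) that unfolding g_def by (rule f_the_inv_into_f_bij_betw)
  have gf: "g (f x) = x" if "x \<in> pverts X" for x
    using f(1) that unfolding g_def by (auto simp: bij_betw_def the_inv_into_f_f)
  have gV: "g y \<in> pverts X" if "y \<in> carrier G" for y using g that by (auto simp: bij_betw_def)
  have fV: "f x \<in> carrier G" if "x \<in> pverts X" for x using f(1) that by (auto simp: bij_betw_def)
  define H where "H = \<lparr>carrier = pverts X, monoid.mult = \<lambda>x y. g (f x \<otimes>\<^bsub>G\<^esub> f y), one = g \<one>\<^bsub>G\<^esub>\<rparr>"
  have H: "group H"
  proof (rule groupI)
    fix x assume x: "x \<in> carrier H"
    then have "g (inv\<^bsub>G\<^esub> f x) \<in> carrier H" "g (inv\<^bsub>G\<^esub> f x) \<otimes>\<^bsub>H\<^esub> x = \<one>\<^bsub>H\<^esub>"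
      by (auto simp: H_def gV fV fg)
    then show "\<exists>y \<in> carrier H. y \<otimes>\<^bsub>H\<^esub> x = \<one>\<^bsub>H\<^esub>" by blast
  qed (auto simp: H_def gV fV fg gf G.m_assoc)
  interpret H: group H by fact
  have SG: "S \<subseteq> carrier G" using S by auto
  have inv: "inv\<^bsub>H\<^esub> (g s) = g (inv\<^bsub>G\<^esub> s)" if "s \<in> S" for s
    by (rule H.inv_equality) (use that SG in \<open>auto simp: H_def gV fV fg subset_iff\<close>)
  have "inj_on g (carrier G)" using g by (simp add: bij_betw_def)
  then have S': "g ` S \<subseteq> carrier H - {\<one>\<^bsub>H\<^esub>}"
    using S SG gV by (auto simp: H_def inj_on_eq_iff subset_iff)
  have arcs: "(x, y) \<in> parcs X \<longleftrightarrow> x \<in> pverts X \<and> y \<in> pverts X \<and> (f x, f y) \<in> parcs (cayley_graph G S)" for x y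
  proof
    interpret pair_wf_digraph X by (fact assms)
    assume "(x, y) \<in> parcs X"
    then show "x \<in> pverts X \<and> y \<in> pverts X \<and> (f x, f y) \<in> parcs (cayley_graph G S)"
      using f(2) in_arcsD1 in_arcsD2 by force
  next
    interpret pair_wf_digraph X by (fact assms)
    assume xy: "x \<in> pverts X \<and> y \<in> pverts X \<and> (f x, f y) \<in> parcs (cayley_graph G S)"
    then have "(f x, f y) \<in> map_prod f f ` parcs X" by (simp add: f(2))
    then obtain x' y' where a: "(x', y') \<in> parcs X" "f x' = f x" "f y' = f y" by force
    then have "x' = x" "y' = y"
      using xy gf[of x] gf[of y] gf[OF in_arcsD1[OF a(1)]] gf[OF in_arcsD2[OF a(1)]] by auto
    then show "(x, y) \<in> parcs X" using a(1) by simp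
  qed
  have "parcs (cayley_graph H (g ` S)) = parcs X"
  proof (intro equalityI subsetI)
    fix a assume "a \<in> parcs (cayley_graph H (g ` S))"
    then obtain x s where "a = (x, g (f x \<otimes>\<^bsub>G\<^esub> f (g s)))" "x \<in> pverts X" "s \<in> S"
      by (auto simp: cayley_graph_def H_def)
    then show "a \<in> parcs X"
      using SG by (auto simp: arcs fg gV fV subset_iff cayley_graph_def)
  next
    fix a assume a: "a \<in> parcs X"
    obtain x y where xy: "a = (x, y)" by (cases a)
    with a arcs obtain s where s: "x \<in> pverts X" "y \<in> pverts X" "s \<in> S" "f y = f x \<otimes>\<^bsub>G\<^esub> s"
      by (auto simp: cayley_graph_def)
    then have "y = g (f x \<otimes>\<^bsub>G\<^esub> f (g s))" using gf[of y] fg[of s] SG by auto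
    then show "a \<in> parcs (cayley_graph H (g ` S))" using s xy by (auto simp: cayley_graph_def H_def)
  qed
  then have "cayley_graph H (g ` S) = X" by (simp add: cayley_graph_def H_def)
  moreover have "digraph_iso (with_proj X) (with_proj X)"
    unfolding digraph_iso_pair_iff[OF assms(1)] by (rule exI[of _ id]) (simp add: map_prod.id)
  ultimately show ?thesis
    unfolding is_cayley_graph_def using H S' S(2) inv by (intro exI[of _ H] exI[of _ "g ` S"]) auto
qed

text \<open>The maxima above are taken over finite nonempty sets.\<close>

lemma symmetric_cycle_finite_nonempty:
  assumes "pair_wf_digraph X" "hamilton_cycle X C"
  shows "finite {k. symmetric_cycle X C k}" "symmetric_cycle X C 1"
proof -
  have "{k. symmetric_cycle X C k} \<subseteq> {..length C}"
    using assms(2) by (auto simp: symmetric_cycle_def hamilton_cycle_def intro!: dvd_imp_le)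
  then show "finite {k. symmetric_cycle X C k}" by (rule finite_subset) simp
  have "automorphism X id" using assms(1) by (simp add: automorphism_iff map_prod.id)
  then show "symmetric_cycle X C 1"
    unfolding symmetric_cycle_def by (intro conjI exI[of _ id]) auto
qed

lemma finite_compression_factors:
  assumes "pair_graph X"
  shows "finite {compression_factor X C | C. hamilton_cycle X C}"
proof -
  interpret pair_graph X by fact
  have "{C. hamilton_cycle X C} \<subseteq> {C. set C \<subseteq> pverts X \<and> length C \<le> card (pverts X)}"
    by (auto simp: hamilton_cycle_def dest: distinct_card)
  then have "finite {C. hamilton_cycle X C}"
    using finite_lists_length_le[OF pair_finite_verts] by (rule finite_subset)
  then show ?thesis by simp
qed

end

theory Submission
  imports Defs "HOL-Algebra.Sylow"
begin

text \<open>
  Let \<open>p > 5\<close> be a prime with \<open>p \<equiv> 1\<close> modulo 4 and \<open>k\<close> a square root of \<open>-1\<close> modulo \<open>p\<close>. Take two copies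
  of the integers modulo \<open>p\<close>; in the first copy join \<open>x\<close> to \<open>x \<plusminus> 1\<close> and \<open>x \<plusminus> 2\<close>, in the second copy
  join \<open>x\<close> to \<open>x \<plusminus> k\<close> and \<open>x \<plusminus> 2k\<close>, and join the two copies of each \<open>x\<close> by a spoke. This is a
  relative of the generalized Petersen graph with parameters \<open>p\<close> and \<open>k\<close>, with squared cycles instead
  of cycles. The extra edges make triangles, and these make the automorphism group easy to find and
  a Hamilton cycle easy to write down.

  Translations, together with the map that exchanges the copies and multiplies by \<open>k\<close>, are
  automorphisms because \<open>k\<^sup>2 = -1\<close>; they act transitively. Conversely, the edges that lie in two
  triangles are exactly those of the two \<open>p\<close>-cycles of steps \<open>\<plusminus>1\<close> and \<open>\<plusminus>k\<close>, and it follows that every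
  automorphism is \<open>x \<mapsto> ax + b\<close> on both copies, where \<open>a = \<plusminus>1\<close> if it preserves the copies and
  \<open>a = \<plusminus>k\<close> if it exchanges them (\<open>automorphism_X_affine\<close>).

  The heart of the matter is that an involutory automorphism fixes a vertex
  (\<open>involution_fixes_vertex\<close>): it cannot exchange the copies, since then its square would have slope
  \<open>k\<^sup>2 = -1\<close>, and a reflection \<open>x \<mapsto> b - x\<close> fixes \<open>b/2\<close>, as \<open>p\<close> is odd. This has two consequences.
  A Cayley graph of even order has an automorphism that is an involution without fixed vertices,
  namely translation by an element of order 2 of the group, so the graph is not a Cayley graph
  (\<open>not_cayley_X\<close>). And no Hamilton cycle, which has length \<open>2p\<close>, can be \<open>r\<close>-symmetric for an even
  number \<open>r\<close>. For \<open>r = p\<close> the cycle would be rotated by two steps by an automorphism of odd order;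
  this preserves the copies, so the cycle would alternate between the copies and would use spokes
  only, which is absurd as the spokes form a matching. So only \<open>r = 1\<close> remains
  (\<open>no_rotational_symmetry\<close>), and as there is a Hamilton cycle (\<open>hamilton_cycle_X\<close>) the Hamilton
  compression is 1.
\<close>

section \<open>Automorphisms, cycles and Cayley graphs\<close>

text \<open>
  On a finite graph an injective endomorphism is onto, both on the vertices and on the arcs.
\<close>

lemma automorphismI:
  assumes "pair_graph X"
    and maps: "\<And>v. v \<in> pverts X \<Longrightarrow> \<alpha> v \<in> pverts X"
    and inj: "inj_on \<alpha> (pverts X)"
    and arcs: "\<And>u v. (u, v) \<in> parcs X \<Longrightarrow> (\<alpha> u, \<alpha> v) \<in> parcs X"
  shows "automorphism X \<alpha>"
proof -
  interpret pair_graph X by fact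
  have "bij_betw \<alpha> (pverts X) (pverts X)"
    using endo_inj_surj[OF _ _ inj] maps inj by (auto simp: bij_betw_def)
  moreover have "inj_on (map_prod \<alpha> \<alpha>) (parcs X)"
    using map_prod_inj_on[OF inj inj] by (rule inj_on_subset) (use in_arcsD1 in_arcsD2 in auto)
  then have "map_prod \<alpha> \<alpha> ` parcs X = parcs X"
    using arcs by (intro endo_inj_surj) auto
  ultimately show ?thesis
    by (simp add: automorphism_iff[OF wf_digraph_wp_iff[THEN iffD1, OF wf_digraph]])
qed

lemma automorphism_funpow:
  assumes "pair_graph X" "automorphism X \<alpha>"
  shows "automorphism X (\<alpha> ^^ j)"
proof -
  interpret pair_graph X by fact
  have wf: "pair_wf_digraph X" by unfold_locales
  have \<alpha>: "bij_betw \<alpha> (pverts X) (pverts X)" "map_prod \<alpha> \<alpha> ` parcs X = parcs X"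
    using assms(2) by (auto simp: automorphism_iff[OF wf])
  have "map_prod (\<alpha> ^^ j) (\<alpha> ^^ j) ` parcs X = parcs X"
  proof (induction j)
    case (Suc j)
    have "map_prod (\<alpha> ^^ Suc j) (\<alpha> ^^ Suc j) ` parcs X
        = map_prod \<alpha> \<alpha> ` map_prod (\<alpha> ^^ j) (\<alpha> ^^ j) ` parcs X"
      unfolding image_comp map_prod.comp funpow.simps ..
    with Suc \<alpha>(2) show ?case by (simp only:)
  qed (simp add: map_prod.id)
  then show ?thesis
    using bij_betw_funpow[OF \<alpha>(1)] by (simp add: automorphism_iff[OF wf])
qed

lemma successively_imp_cyclically_adjacent:
  assumes "successively P C" "C \<noteq> []" "P (last C) (hd C)" "i < length C"
  shows "P (C ! i) (C ! ((i + 1) mod length C))"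
proof (cases "Suc i < length C")
  case True
  then show ?thesis using assms(1) by (simp add: successively_conv_nth)
next
  case False
  then have "i = length C - 1" using assms(4) by linarith
  then show ?thesis using assms(2,3) by (simp add: last_conv_nth hd_conv_nth)
qed

text \<open>
  A Sylow theorem with exponent 1 gives a subgroup of order 2, even when 2 is not the full power of 2
  in the order of the group.
\<close>

lemma group_even_order_involution:
  assumes "group G" "finite (carrier G)" "order G = 2 * q"
  shows "\<exists>h \<in> carrier G. h \<noteq> \<one>\<^bsub>G\<^esub> \<and> h \<otimes>\<^bsub>G\<^esub> h = \<one>\<^bsub>G\<^esub>"
proof -
  interpret group G by fact
  obtain H where H: "subgroup H G" "card H = 2"
    using sylow_thm[of 2 G 1 q] assms by auto
  interpret H: subgroup H G by (fact H(1))
  obtain x y where "H = {x, y}" "x \<noteq> y" using H(2) by (auto simp: card_2_iff)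
  then obtain h where h: "h \<in> H" "h \<noteq> \<one>\<^bsub>G\<^esub>" "H = {\<one>\<^bsub>G\<^esub>, h}"
    using H.one_closed by (cases "x = \<one>\<^bsub>G\<^esub>") auto
  then have "h \<otimes>\<^bsub>G\<^esub> h \<in> {\<one>\<^bsub>G\<^esub>, h}" using H.m_closed by blast
  moreover have "h \<otimes>\<^bsub>G\<^esub> h \<noteq> h" using h H.mem_carrier l_cancel_one by auto
  ultimately show ?thesis using h H.mem_carrier by auto
qed

text \<open>
  This is the obstruction used against Cayley graphs. The connection set of a Cayley graph multiplies
  on the right, so multiplication on the left by a group element is an automorphism; it moves every
  vertex unless the element is the identity. The element of order 2 is what even order provides.
\<close>

lemma cayley_graph_involution:
  assumes X: "pair_graph X" and cay: "is_cayley_graph X" and even: "card (pverts X) = 2 * q"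
    and "q > 0"
  shows "\<exists>\<alpha>. automorphism X \<alpha> \<and> (\<forall>v \<in> pverts X. \<alpha> (\<alpha> v) = v \<and> \<alpha> v \<noteq> v)"
proof -
  interpret pair_graph X by fact
  have wf: "pair_wf_digraph X" by unfold_locales
  obtain G :: "'a monoid" and S where G: "group G" "S \<subseteq> carrier G"
    and iso: "digraph_iso (with_proj X) (with_proj (cayley_graph G S))"
    using cay unfolding is_cayley_graph_def by blast
  interpret G: group G by fact
  obtain f where f: "bij_betw f (pverts X) (carrier G)"
      "map_prod f f ` parcs X = parcs (cayley_graph G S)"
    using iso unfolding digraph_iso_pair_iff[OF wf] by (auto simp: cayley_graph_def)
  define g where "g = the_inv_into (pverts X) f"
  have fg: "f (g y) = y" if "y \<in> carrier G" for y
    using f(1) that unfolding g_def by (rule f_the_inv_into_f_bij_betw)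
  have gf: "g (f x) = x" if "x \<in> pverts X" for x
    using f(1) that unfolding g_def by (auto simp: bij_betw_def the_inv_into_f_f)
  have gV: "g y \<in> pverts X" if "y \<in> carrier G" for y
    using bij_betw_the_inv_into[OF f(1)] that unfolding g_def by (auto simp: bij_betw_def)
  have fV: "f x \<in> carrier G" if "x \<in> pverts X" for x using f(1) that by (auto simp: bij_betw_def)
  have "order G = 2 * q" using bij_betw_same_card[OF f(1)] even by (simp add: order_def)
  moreover have "finite (carrier G)" using bij_betw_finite[OF f(1)] by simp
  ultimately obtain h where h: "h \<in> carrier G" "h \<noteq> \<one>\<^bsub>G\<^esub>" "h \<otimes>\<^bsub>G\<^esub> h = \<one>\<^bsub>G\<^esub>"
    using group_even_order_involution[OF G(1)] by blast
  define \<alpha> where "\<alpha> v = g (h \<otimes>\<^bsub>G\<^esub> f v)" for v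
  have f\<alpha>: "f (\<alpha> v) = h \<otimes>\<^bsub>G\<^esub> f v" if "v \<in> pverts X" for v
    using that h fV by (simp add: \<alpha>_def fg)
  have \<alpha>V: "\<alpha> v \<in> pverts X" if "v \<in> pverts X" for v
    using that h fV by (simp add: \<alpha>_def gV)
  have inv: "\<alpha> (\<alpha> v) = v" if v: "v \<in> pverts X" for v
  proof -
    have "f (\<alpha> (\<alpha> v)) = (h \<otimes>\<^bsub>G\<^esub> h) \<otimes>\<^bsub>G\<^esub> f v"
      using v h(1) fV by (simp add: f\<alpha> \<alpha>V G.m_assoc)
    then have "f (\<alpha> (\<alpha> v)) = f v" using v fV by (simp only: h(3) G.l_one)
    then show ?thesis using gf v \<alpha>V by metis
  qed
  have "\<alpha> v \<noteq> v" if v: "v \<in> pverts X" for v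
  proof
    assume "\<alpha> v = v"
    then have "h \<otimes>\<^bsub>G\<^esub> f v = f v" using f\<alpha>[OF v] by simp
    then show False using h fV[OF v] by (simp add: G.r_cancel_one)
  qed
  moreover have "automorphism X \<alpha>"
  proof (rule automorphismI[OF X])
    show "inj_on \<alpha> (pverts X)" by (metis inj_onI inv)
    fix u v assume uv: "(u, v) \<in> parcs X"
    then have V: "u \<in> pverts X" "v \<in> pverts X" using in_arcsD1 in_arcsD2 by auto
    have "(f u, f v) \<in> parcs (cayley_graph G S)" using uv f(2) by (metis image_eqI map_prod_simp)
    then obtain s where s: "s \<in> S" "f v = f u \<otimes>\<^bsub>G\<^esub> s" by (auto simp: cayley_graph_def)
    then have "f (\<alpha> v) = f (\<alpha> u) \<otimes>\<^bsub>G\<^esub> s"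
      using V h fV G(2) by (simp add: f\<alpha> G.m_assoc subset_iff)
    then have "(f (\<alpha> u), f (\<alpha> v)) \<in> parcs (cayley_graph G S)"
      using s V \<alpha>V fV by (auto simp: cayley_graph_def)
    then obtain u' v' where a: "(u', v') \<in> parcs X" "f u' = f (\<alpha> u)" "f v' = f (\<alpha> v)"
      unfolding f(2)[symmetric] by force
    then have "u' = \<alpha> u" "v' = \<alpha> v"
      using gf in_arcsD1[OF a(1)] in_arcsD2[OF a(1)] V \<alpha>V by metis+
    then show "(\<alpha> u, \<alpha> v) \<in> parcs X" using a(1) by simp
  qed (rule \<alpha>V)
  ultimately show ?thesis using inv by blast
qed

section \<open>Two squared cycles joined by a perfect matching\<close>

text \<open>
  The square root of \<open>-1\<close> is taken to be the even number \<open>2 * m\<close>. One of \<open>k\<close> and \<open>p - k\<close> is even, so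
  this costs nothing, and it makes the Hamilton cycle below uniform.
\<close>

locale twisted_square_prism =
  fixes p m :: nat
  assumes prime: "prime p" and p_ge: "p \<ge> 7"
    and m: "0 < m" "2 * m < p"
    and root: "int p dvd (2 * int m)\<^sup>2 + 1"
begin

text \<open>
  A side of the graph is a truth value, and \<open>c s\<close> is the unit of length on side \<open>s\<close>.
\<close>

definition c :: "bool \<Rightarrow> int" where
  "c s = (if s then 2 * int m else 1)"

text \<open>
  Positions are integers that matter modulo \<open>p\<close> only, so that calculations with vertices become
  divisibility statements about integers. The parity of a vertex is its side.
\<close>

definition vtx :: "bool \<Rightarrow> int \<Rightarrow> nat" where
  "vtx s x = 2 * nat (x mod int p) + of_bool s"

definition steps :: "int set" where
  "steps = {1, -1, 2, -2}"

definition X :: "nat pair_pre_digraph" where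
  "X = \<lparr>pverts = {..<2 * p},
     parcs = {(vtx s x, vtx s (x + d * c s)) | s x d. d \<in> steps}
       \<union> {(vtx s x, vtx (\<not> s) x) | s x. True}\<rparr>"

lemma p_pos: "int p > 0" using p_ge by simp

lemma vtx_eq_iff: "vtx s x = vtx t y \<longleftrightarrow> s = t \<and> int p dvd x - y"
proof -
  have "2 * a + of_bool s = 2 * b + of_bool t \<longleftrightarrow> s = t \<and> a = b" for a b :: nat
    by (cases s; cases t; simp; presburger?)
  then have "vtx s x = vtx t y \<longleftrightarrow> s = t \<and> nat (x mod int p) = nat (y mod int p)"
    unfolding vtx_def .
  also have "\<dots> \<longleftrightarrow> s = t \<and> x mod int p = y mod int p"
    using p_pos by (simp add: eq_nat_nat_iff)
  finally show ?thesis by (simp add: mod_eq_dvd_iff)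
qed

lemma vtx_in: "vtx s x < 2 * p"
proof -
  have "nat (x mod int p) < p" using p_pos by (simp add: nat_less_iff)
  then show ?thesis by (cases s) (auto simp: vtx_def)
qed

lemma vtx_cases:
  assumes "v < 2 * p"
  obtains s x where "v = vtx s (int x)" "x < p"
proof -
  have "v = vtx (odd v) (int (v div 2))" using assms by (auto simp: vtx_def)
  then show ?thesis using that assms by (metis less_mult_imp_div_less mult.commute)
qed

lemma pverts_X: "v \<in> pverts X \<longleftrightarrow> v < 2 * p" by (simp add: X_def)

lemma dvd_mult_c_iff: "int p dvd a * c s \<longleftrightarrow> int p dvd a"
proof -
  have "\<not> int p dvd c s"
    using m p_ge by (auto simp: c_def dest!: zdvd_imp_le)
  then show ?thesis using prime prime_dvd_mult_iff[of "int p"] by auto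
qed

text \<open>
  All coincidences between sums of few steps are excluded by this bound.
\<close>

lemma dvd_small: "int p dvd a \<Longrightarrow> \<bar>a\<bar> < 7 \<Longrightarrow> a = 0"
  using p_ge dvd_imp_le_int[of a "int p"] by force

lemma c_squared: "int p dvd (c True)\<^sup>2 + 1" using root by (simp add: c_def)

lemma arc_iff:
  "(vtx s x, vtx t y) \<in> parcs X \<longleftrightarrow>
     (s = t \<and> (\<exists>d \<in> steps. int p dvd y - x - d * c s)) \<or> (s \<noteq> t \<and> int p dvd x - y)"
  (is "?L \<longleftrightarrow> ?R")
proof
  assume ?L
  then consider s' x' d where "d \<in> steps" "vtx s x = vtx s' x'" "vtx t y = vtx s' (x' + d * c s')"
    | s' x' where "vtx s x = vtx s' x'" "vtx t y = vtx (\<not> s') x'"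
    by (auto simp: X_def)
  then show ?R
  proof cases
    case 1
    then have st: "s = t" "int p dvd x - x'" "int p dvd y - (x' + d * c s)"
      by (auto simp: vtx_eq_iff)
    have "int p dvd y - x - d * c s"
      using dvd_diff[OF st(3,2)] by (simp add: algebra_simps)
    then show ?thesis using 1(1) st(1) by blast
  next
    case 2
    then have st: "s \<noteq> t" "int p dvd x - x'" "int p dvd y - x'"
      by (auto simp: vtx_eq_iff)
    then show ?thesis using dvd_diff[OF st(2,3)] by simp
  qed
next
  assume R: ?R
  show ?L
  proof (cases "s = t")
    case True
    with R obtain d where d: "d \<in> steps" "int p dvd y - x - d * c s" by auto
    then have "vtx t y = vtx s (x + d * c s)"
      using True by (simp add: vtx_eq_iff algebra_simps)
    then show ?thesis using d by (auto simp: X_def)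
  next
    case False
    then have "vtx t y = vtx (\<not> s) x" using R by (auto simp: vtx_eq_iff dvd_diff_commute)
    then show ?thesis by (auto simp: X_def)
  qed
qed

lemma arc_cases:
  assumes "(u, v) \<in> parcs X"
  obtains s x t y where "u = vtx s x" "v = vtx t y"
  using assms by (auto simp: X_def)

lemma pair_graph_X: "pair_graph X"
proof
  fix e assume "e \<in> parcs X"
  then show "fst e \<in> pverts X" "snd e \<in> pverts X"
    by (auto simp: X_def vtx_in)
  show "fst e \<noteq> snd e"
  proof
    assume "fst e = snd e"
    obtain s x where "fst e = vtx s x"
      using \<open>e \<in> parcs X\<close> by (auto simp: X_def)
    then have "(vtx s x, vtx s x) \<in> parcs X"
      using \<open>e \<in> parcs X\<close> \<open>fst e = snd e\<close> by (metis prod.collapse)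
    then obtain d where "d \<in> steps" "int p dvd d * c s" unfolding arc_iff by auto
    then show False using dvd_mult_c_iff dvd_small[of d] by (auto simp: steps_def)
  qed
next
  show fin: "finite (pverts X)" by (simp add: X_def)
  have "parcs X \<subseteq> {..<2 * p} \<times> {..<2 * p}" by (auto simp: X_def vtx_in)
  then show "finite (parcs X)" by (rule finite_subset) simp
next
  have "(vtx t y, vtx s x) \<in> parcs X" if "(vtx s x, vtx t y) \<in> parcs X" for s x t y
  proof (cases "s = t")
    case True
    then obtain d where d: "d \<in> steps" "int p dvd y - x - d * c s"
      using \<open>(vtx s x, vtx t y) \<in> parcs X\<close> unfolding arc_iff by auto
    then have "- d \<in> steps" "int p dvd x - y - (- d) * c s"
      by (auto simp: steps_def) (simp_all add: dvd_diff_commute algebra_simps)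
    then show ?thesis using True arc_iff by blast
  next
    case False
    then show ?thesis using that unfolding arc_iff by (auto simp: dvd_diff_commute)
  qed
  then have "(v, u) \<in> parcs X" if "(u, v) \<in> parcs X" for u v
    using that by (metis arc_cases)
  then show "symmetric (with_proj X)"
    by (auto simp: symmetric_def intro!: symI)
qed


lemma odd_vtx [simp]: "odd (vtx s x) \<longleftrightarrow> s" by (simp add: vtx_def)

lemma card_pverts_X: "card (pverts X) = 2 * p" by (simp add: X_def)

lemma vtx_in_X [simp]: "vtx s x \<in> pverts X" by (simp add: pverts_X vtx_in)

section \<open>The automorphism group\<close>

text \<open>
  With \<open>t\<close> false these are the translations; with \<open>t\<close> true the sides are exchanged. Multiplication
  by \<open>c True\<close> maps steps of side \<open>False\<close> to steps of side \<open>True\<close>, and it maps steps of side \<open>True\<close> to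
  negatives of steps of side \<open>False\<close>, because \<open>c True\<close> is a square root of \<open>-1\<close>.
\<close>

definition affine :: "bool \<Rightarrow> int \<Rightarrow> nat \<Rightarrow> nat" where
  "affine t b v = vtx (odd v \<noteq> t) (c t * int (v div 2) + b)"

lemma affine_vtx: "affine t b (vtx s x) = vtx (s \<noteq> t) (c t * x + b)"
proof -
  have "int (vtx s x div 2) = x mod int p" using p_pos by (simp add: vtx_def)
  moreover have "int p dvd c t * (x mod int p) - c t * x"
    by (metis dvd_mult mod_eq_dvd_iff mod_mod_trivial right_diff_distrib)
  ultimately show ?thesis by (simp add: affine_def vtx_eq_iff)
qed

lemma automorphism_affine: "automorphism X (affine t b)"
proof (rule automorphismI[OF pair_graph_X])
  show "affine t b v \<in> pverts X" for v by (simp add: affine_def)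
  show "inj_on (affine t b) (pverts X)"
  proof (rule inj_onI)
    fix u v assume "u \<in> pverts X" "v \<in> pverts X" and eq: "affine t b u = affine t b v"
    then obtain s x s' x' where uv: "u = vtx s x" "v = vtx s' x'"
      by (metis pverts_X vtx_cases)
    then have "s = s'" "int p dvd (x - x') * c t"
      using eq by (auto simp: affine_vtx vtx_eq_iff algebra_simps)
    then show "u = v" by (simp add: uv vtx_eq_iff dvd_mult_c_iff)
  qed
  fix u v assume "(u, v) \<in> parcs X"
  then consider (side) s x d where "d \<in> steps" "u = vtx s x" "v = vtx s (x + d * c s)"
    | (spoke) s x where "u = vtx s x" "v = vtx (\<not> s) x"
    by (auto simp: X_def)
  then show "(affine t b u, affine t b v) \<in> parcs X"
  proof cases
    case side
    show ?thesis
    proof (cases "s \<and> t")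
      case True
      then have "- d \<in> steps" using side(1) by (auto simp: steps_def)
      moreover have "int p dvd d * ((c True)\<^sup>2 + 1)" using c_squared by (rule dvd_mult)
      then have "int p dvd (c t * (x + d * c s) + b) - (c t * x + b) - (- d) * c (s \<noteq> t)"
        using True by (simp add: algebra_simps power2_eq_square c_def)
      ultimately show ?thesis using side by (auto simp: affine_vtx arc_iff intro!: bexI[of _ "- d"])
    next
      case False
      then have "(c t * (x + d * c s) + b) - (c t * x + b) - d * c (s \<noteq> t) = 0"
        by (auto simp: algebra_simps c_def)
      then show ?thesis using side by (auto simp: affine_vtx arc_iff intro!: bexI[of _ d])
    qed
  next
    case spoke
    then show ?thesis by (auto simp: affine_vtx arc_iff)
  qed
qed

lemma vertex_transitive_X: "vertex_transitive X"
  unfolding vertex_transitive_def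
proof (intro ballI)
  fix u v assume "u \<in> pverts X" "v \<in> pverts X"
  then obtain s x t y where uv: "u = vtx s x" "v = vtx t y"
    by (metis pverts_X vtx_cases)
  then have "affine (s \<noteq> t) (y - c (s \<noteq> t) * x) u = v"
    by (cases s; cases t) (simp_all add: affine_vtx vtx_eq_iff)
  then show "\<exists>\<alpha>. automorphism X \<alpha> \<and> \<alpha> u = v" using automorphism_affine by blast
qed

text \<open>
  An isomorphism invariant of edges that singles out the steps of unit length.
\<close>

definition in_two_triangles :: "nat \<Rightarrow> nat \<Rightarrow> bool" where
  "in_two_triangles u v \<longleftrightarrow> (u, v) \<in> parcs X \<and>
     (\<exists>z w. z \<noteq> w \<and> (u, z) \<in> parcs X \<and> (z, v) \<in> parcs X \<and> (u, w) \<in> parcs X \<and> (w, v) \<in> parcs X)"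

lemma short_edge_in_two_triangles: "in_two_triangles (vtx s x) (vtx s (x + c s))"
proof -
  have "vtx s (x + 2 * c s) \<noteq> vtx s (x - c s)"
    using dvd_mult_c_iff[of 3 s] dvd_small[of 3] by (auto simp: vtx_eq_iff)
  moreover have "(vtx s y, vtx s (y + d * c s)) \<in> parcs X" if "d \<in> steps" for y d
    using that by (auto simp: X_def)
  from this[of 1 x] this[of 2 x] this[of "-1" "x + 2 * c s"] this[of "-1" x] this[of 2 "x - c s"]
  have "(vtx s x, vtx s (x + c s)) \<in> parcs X" "(vtx s x, vtx s (x + 2 * c s)) \<in> parcs X"
    "(vtx s (x + 2 * c s), vtx s (x + c s)) \<in> parcs X"
    "(vtx s x, vtx s (x - c s)) \<in> parcs X" "(vtx s (x - c s), vtx s (x + c s)) \<in> parcs X"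
    by (simp_all add: steps_def algebra_simps)
  ultimately show ?thesis unfolding in_two_triangles_def by blast
qed

text \<open>
  A triangle with vertices on both sides would have two spokes, so its three vertices would have the
  same position, and its third edge would be a loop. A triangle on one side amounts to an equation
  between steps, which holds exactly and not only modulo \<open>p\<close>, as \<open>p\<close> is large.
\<close>

lemma common_neighbour:
  assumes "(vtx s x, vtx t y) \<in> parcs X" "(vtx s x, vtx r z) \<in> parcs X" "(vtx r z, vtx t y) \<in> parcs X"
  obtains d e where "s = t" "r = t" "d \<in> steps" "e \<in> steps" "d + e \<in> steps"
    "int p dvd y - x - (d + e) * c s" "int p dvd z - x - d * c s"
proof -
  have stepF: False if "int p dvd a - b - d * c r" "int p dvd a - b" "d \<in> steps" for a b d r
  proof -
    have "int p dvd d * c r" using dvd_diff[OF that(2,1)] by simp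
    then show False using that(3) dvd_mult_c_iff dvd_small[of d] by (auto simp: steps_def)
  qed
  have st: "s = t"
  proof (rule ccontr)
    assume "s \<noteq> t"
    then have xy: "int p dvd x - y" using assms(1) by (simp add: arc_iff)
    show False
    proof (cases "r = s")
      case True
      then obtain d where "d \<in> steps" "int p dvd z - x - d * c s"
        using assms(2) by (auto simp: arc_iff)
      moreover have "int p dvd z - y" using True \<open>s \<noteq> t\<close> assms(3) by (simp add: arc_iff)
      then have "int p dvd z - x" using dvd_diff[OF _ xy, of "z - y"] by (simp add: dvd_diff_commute)
      ultimately show False using stepF by blast
    next
      case False
      then have "r = t" using \<open>s \<noteq> t\<close> by auto
      then obtain d where "d \<in> steps" "int p dvd y - z - d * c r"
        using assms(3) by (auto simp: arc_iff)
      moreover have "int p dvd x - z" using False assms(2) by (simp add: arc_iff)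
      then have "int p dvd y - z" using dvd_diff[OF _ xy, of "x - z"] by simp
      ultimately show False using stepF by blast
    qed
  qed
  obtain d0 where d0: "d0 \<in> steps" "int p dvd y - x - d0 * c s"
    using assms(1) st by (auto simp: arc_iff)
  have rt: "r = t"
  proof (rule ccontr)
    assume "r \<noteq> t"
    then have "int p dvd x - z" "int p dvd z - y" using assms(2,3) st by (auto simp: arc_iff)
    from dvd_add[OF this] have "int p dvd y - x" by (simp add: dvd_diff_commute)
    with d0 show False using stepF by blast
  qed
  obtain d e where de: "d \<in> steps" "int p dvd z - x - d * c s" "e \<in> steps" "int p dvd y - z - e * c s"
    using assms(2,3) st rt by (auto simp: arc_iff)
  have sum: "int p dvd y - x - (d + e) * c s"
    using dvd_add[OF de(2,4)] by (simp add: algebra_simps)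
  have "int p dvd (d + e - d0) * c s" using dvd_diff[OF d0(2) sum] by (simp add: algebra_simps)
  then have "d + e - d0 = 0"
    using d0(1) de(1,3) dvd_small[of "d + e - d0"] by (auto simp: steps_def dvd_mult_c_iff)
  then show ?thesis using that[OF st rt de(1,3)] d0(1) sum de(2) by simp
qed

text \<open>
  The edge of step \<open>2\<close> lies in one triangle only, because \<open>2 = 1 + 1\<close> is the only way to write \<open>2\<close> as
  a sum of two steps; the same holds for \<open>-2\<close>.
\<close>

lemma in_two_trianglesD:
  assumes "in_two_triangles (vtx s x) (vtx t y)"
  shows "s = t \<and> (int p dvd y - x - c t \<or> int p dvd y - x + c t)"
proof -
  obtain u v where uv: "(vtx s x, vtx t y) \<in> parcs X" "u \<noteq> v"
      "(vtx s x, u) \<in> parcs X" "(u, vtx t y) \<in> parcs X"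
      "(vtx s x, v) \<in> parcs X" "(v, vtx t y) \<in> parcs X"
    using assms unfolding in_two_triangles_def by blast
  obtain r z r' w where "u = vtx r z" "v = vtx r' w" using uv(3,5) by (metis arc_cases)
  note uv = uv[unfolded this]
  obtain d e where 1: "s = t" "r = t" "d \<in> steps" "e \<in> steps" "d + e \<in> steps"
    "int p dvd y - x - (d + e) * c s" "int p dvd z - x - d * c s"
    using common_neighbour[OF uv(1,3,4)] .
  obtain d' e' where 2: "r' = t" "d' \<in> steps" "e' \<in> steps" "d' + e' \<in> steps"
    "int p dvd y - x - (d' + e') * c s" "int p dvd w - x - d' * c s"
    using common_neighbour[OF uv(1,5,6)] by metis
  have "int p dvd (d + e - (d' + e')) * c s"
    using dvd_diff[OF 2(5) 1(6)] by (simp add: algebra_simps)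
  then have sum: "d + e = d' + e'"
    using 1(5) 2(4) dvd_small[of "d + e - (d' + e')"]
    by (simp only: dvd_mult_c_iff) (auto simp: steps_def)
  have "d \<noteq> d'"
  proof
    assume "d = d'"
    then have "int p dvd z - w" using dvd_diff[OF 1(7) 2(6)] by simp
    with 1(2) 2(1) uv(2) show False by (simp add: vtx_eq_iff)
  qed
  moreover have "d = 1" if "d \<in> steps" "e \<in> steps" "d + e = 2" for d e
    using that by (auto simp: steps_def)
  moreover have "d = - 1" if "d \<in> steps" "e \<in> steps" "d + e = - 2" for d e
    using that by (auto simp: steps_def)
  ultimately have "d + e \<noteq> 2" "d + e \<noteq> - 2" using sum 1(3,4) 2(2,3) by metis+
  then have "d + e = 1 \<or> d + e = - 1" using 1(5) by (simp add: steps_def)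
  then show ?thesis using 1(1,6) by auto
qed

text \<open>
  An automorphism preserves the edges in two triangles. These form one cycle through all positions of
  each side, so each side goes to a side, and the induced map on positions advances by \<open>\<plusminus> c t\<close> in each
  step. As the map is injective, it cannot turn back, so the sign is constant and the map is affine on
  side \<open>False\<close>; the spokes carry the same map over to side \<open>True\<close>.
\<close>

lemma automorphism_X_affine:
  assumes "automorphism X \<alpha>"
  obtains t a b where "a = c t \<or> a = - c t" "\<And>s x. \<alpha> (vtx s x) = vtx (s \<noteq> t) (a * x + b)"
proof -
  interpret pair_graph X by (rule pair_graph_X)
  have wf: "pair_wf_digraph X" by unfold_locales
  have bij: "bij_betw \<alpha> (pverts X) (pverts X)" and "map_prod \<alpha> \<alpha> ` parcs X = parcs X"
    using assms by (auto simp: automorphism_iff[OF wf])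
  then have arc: "(\<alpha> u, \<alpha> v) \<in> parcs X" if "(u, v) \<in> parcs X" for u v
    using that by (metis image_eqI map_prod_simp)
  have inj: "\<alpha> u = \<alpha> v \<longleftrightarrow> u = v" if "u \<in> pverts X" "v \<in> pverts X" for u v
    using bij that by (auto simp: bij_betw_def inj_on_def)
  have two: "in_two_triangles (\<alpha> u) (\<alpha> v)" if "in_two_triangles u v" for u v
  proof -
    obtain z w where zw: "(u, v) \<in> parcs X" "z \<noteq> w" "(u, z) \<in> parcs X" "(z, v) \<in> parcs X"
        "(u, w) \<in> parcs X" "(w, v) \<in> parcs X"
      using \<open>in_two_triangles u v\<close> unfolding in_two_triangles_def by blast
    moreover have "\<alpha> z \<noteq> \<alpha> w" using zw in_arcsD2 inj by blast
    ultimately show ?thesis using arc unfolding in_two_triangles_def by blast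
  qed
  have "\<exists>f h. \<forall>s x. \<alpha> (vtx s x) = vtx (f s x) (h s x)"
  proof -
    have "\<exists>t y. \<alpha> (vtx s x) = vtx t y" for s x
      using bij by (metis bij_betwE pverts_X vtx_cases vtx_in_X)
    then show ?thesis by metis
  qed
  then obtain f h where fh: "\<And>s x. \<alpha> (vtx s x) = vtx (f s x) (h s x)" by blast
  have short: "f s x = f s (x + c s)"
      "int p dvd h s (x + c s) - h s x - c (f s x) \<or> int p dvd h s (x + c s) - h s x + c (f s x)" for s x
    using in_two_trianglesD[of "f s x" "h s x" "f s (x + c s)" "h s (x + c s)"]
      two[OF short_edge_in_two_triangles[of s x]] by (auto simp: fh)
  \<comment> \<open>The unit of length is invertible modulo \<open>p\<close>, so unit steps from \<open>0\<close> reach every position.\<close>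
  have const: "f s x = f s 0" for s x
  proof -
    have iter: "f s (int n * c s) = f s 0" for n
    proof (induction n)
      case (Suc n)
      then show ?case using short(1)[of s "int n * c s"] by (simp add: algebra_simps)
    qed simp
    obtain d where d: "int p dvd d * c s - 1"
    proof (cases s)
      case True
      have "int p dvd - c True * c True - 1"
        using dvd_minus_iff[of "int p" "(c True)\<^sup>2 + 1"] c_squared
        by (simp add: power2_eq_square del: dvd_minus_iff)
      with that[of "- c True"] True show ?thesis by simp
    next
      case False
      with that[of 1] show ?thesis by (simp add: c_def)
    qed
    define n where "n = nat (x * d mod int p)"
    have "int p dvd int n - x * d"
      using p_pos by (simp add: n_def) (metis mod_eq_dvd_iff mod_mod_trivial)
    then have "int p dvd (int n - x * d) * c s + x * (d * c s - 1)" using d by (intro dvd_add) auto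
    then have "vtx s (int n * c s) = vtx s x" by (simp add: vtx_eq_iff algebra_simps)
    then have "f s (int n * c s) = f s x" using fh vtx_eq_iff by metis
    then show ?thesis using iter by simp
  qed
  define t where "t = f False 0"
  define g where "g = h False"
  have g: "\<alpha> (vtx False x) = vtx t (g x)" for x
    by (simp add: fh t_def g_def const[of False x])
  have "f True 0 \<noteq> t"
  proof
    assume "f True 0 = t"
    then have "odd (\<alpha> (vtx s x)) = t" for s x
      using const[of s x] by (cases s) (auto simp: fh t_def)
    moreover obtain v where "v \<in> pverts X" "\<alpha> v = vtx (\<not> t) 0"
      using bij by (metis bij_betw_iff_bijections vtx_in_X)
    ultimately show False by (metis odd_vtx pverts_X vtx_cases)
  qed
  have "\<alpha> (vtx True x) = vtx (\<not> t) (g x)" for x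
  proof -
    have T: "\<alpha> (vtx True x) = vtx (\<not> t) (h True x)"
      using \<open>f True 0 \<noteq> t\<close> const[of True x] by (cases t) (auto simp: fh)
    have "(vtx False x, vtx True x) \<in> parcs X" by (simp add: arc_iff)
    from arc[OF this] have "int p dvd g x - h True x"
      unfolding g T arc_iff by simp
    then show ?thesis by (simp add: T vtx_eq_iff dvd_diff_commute)
  qed
  with g have \<alpha>: "\<alpha> (vtx s x) = vtx (s \<noteq> t) (g x)" for s x by (cases s) auto
  have step: "int p dvd g (x + 1) - g x - c t \<or> int p dvd g (x + 1) - g x + c t" for x
    using short(2)[of False x] const[of False x] by (simp add: g_def t_def c_def)
  have g_inj: "int p dvd x - y" if "int p dvd g x - g y" for x y
    using that inj[of "vtx False x" "vtx False y"] by (simp add: g vtx_eq_iff)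
  obtain a where a: "a = c t \<or> a = - c t" "int p dvd g 1 - g 0 - a"
    using step[of 0] that[of "c t"] that[of "- c t"] by auto
  have step': "int p dvd g (x + 1) - g x - a \<or> int p dvd g (x + 1) - g x + a" for x
    using step[of x] a(1) by auto
  have slope: "int p dvd g (int n + 1) - g (int n) - a" for n
  proof (induction n)
    case 0
    then show ?case using a by simp
  next
    case (Suc n)
    \<comment> \<open>Turning back would identify the positions \<open>n\<close> and \<open>n + 2\<close>.\<close>
    have "\<not> int p dvd g (int n + 2) - g (int n + 1) + a"
    proof
      assume "int p dvd g (int n + 2) - g (int n + 1) + a"
      from dvd_add[OF this Suc] have "int p dvd g (int n + 2) - g (int n)" by simp
      from g_inj[OF this] show False using dvd_small[of 2] by simp
    qed
    then show ?case using step'[of "int n + 1"] by (simp add: algebra_simps)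
  qed
  have lin: "int p dvd g (int n) - (a * int n + g 0)" for n
  proof (induction n)
    case (Suc n)
    show ?case using dvd_add[OF Suc slope[of n]] by (simp add: algebra_simps)
  qed simp
  show ?thesis
  proof (rule that[OF a(1), of "g 0"])
    fix s x
    define n where "n = nat (x mod int p)"
    have n: "int p dvd int n - x"
      using p_pos by (simp add: n_def) (metis mod_eq_dvd_iff mod_mod_trivial)
    then have "\<alpha> (vtx s x) = \<alpha> (vtx s (int n))"
      by (metis dvd_diff_commute vtx_eq_iff)
    also have "\<dots> = vtx (s \<noteq> t) (a * int n + g 0)" using lin by (simp add: \<alpha> vtx_eq_iff)
    also have "\<dots> = vtx (s \<noteq> t) (a * x + g 0)"
      using dvd_mult[OF n, of a] by (simp add: vtx_eq_iff algebra_simps)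
    finally show "\<alpha> (vtx s x) = vtx (s \<noteq> t) (a * x + g 0)" .
  qed
qed

text \<open>
  The square of an automorphism of slope \<open>a\<close> has slope \<open>a\<^sup>2\<close>, and this is \<open>-1\<close> if the sides are
  exchanged. So an involution preserves the sides, and since \<open>p\<close> is odd the equation \<open>ax + b = x\<close> has
  a solution: \<open>b/2\<close> for a reflection, and anything for a translation of order dividing 2, which is
  trivial.
\<close>

lemma involution_fixes_vertex:
  assumes "automorphism X \<alpha>" "\<And>v. v \<in> pverts X \<Longrightarrow> \<alpha> (\<alpha> v) = v"
  shows "\<exists>v \<in> pverts X. \<alpha> v = v"
proof -
  obtain t a b where a: "a = c t \<or> a = - c t" and \<alpha>: "\<And>s x. \<alpha> (vtx s x) = vtx (s \<noteq> t) (a * x + b)"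
    using automorphism_X_affine[OF assms(1)] by metis
  have inv: "int p dvd a * (a * x + b) + b - x" for x
    using assms(2)[of "vtx False x"] by (simp add: \<alpha> vtx_eq_iff)
  have "int p dvd (a * (a * 1 + b) + b - 1) - (a * (a * 0 + b) + b - 0)"
    using inv[of 1] inv[of 0] by (rule dvd_diff)
  then have a2: "int p dvd a\<^sup>2 - 1" by (simp add: algebra_simps power2_eq_square)
  have "\<not> t"
  proof
    assume t
    then have "int p dvd a\<^sup>2 + 1" using a c_squared by auto
    from dvd_diff[OF this a2] show False using dvd_small[of 2] by simp
  qed
  with a consider "a = 1" | "a = - 1" by (auto simp: c_def)
  then show ?thesis
  proof cases
    case 1
    then have "int p dvd 2 * b" using inv[of 0] by simp
    then have "int p dvd b"
      using prime dvd_small[of 2] prime_dvd_mult_iff[of "int p" 2 b] by auto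
    then show ?thesis using \<alpha>[of False 0] \<open>\<not> t\<close> by (intro bexI[of _ "vtx False 0"]) (auto simp: vtx_eq_iff)
  next
    case 2
    obtain q where q: "p = 2 * q + 1" using prime p_ge prime_odd_nat[of p] by (auto elim: oddE)
    \<comment> \<open>Modulo \<open>p\<close>, the number \<open>q + 1\<close> is the inverse of 2.\<close>
    have "- (b * (int q + 1)) + b - b * (int q + 1) = - (b * int p)"
      using arg_cong[OF q, of int] by (simp add: algebra_simps)
    then have "vtx False (- (b * (int q + 1)) + b) = vtx False (b * (int q + 1))"
      by (simp add: vtx_eq_iff)
    then show ?thesis using \<alpha>[of False "b * (int q + 1)"] 2 \<open>\<not> t\<close>
      by (intro bexI[of _ "vtx False (b * (int q + 1))"]) auto
  qed
qed

lemma not_cayley_X: "\<not> is_cayley_graph X"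
  using cayley_graph_involution[OF pair_graph_X _ card_pverts_X] involution_fixes_vertex p_ge
  by (metis gr0I not_numeral_le_zero)


section \<open>Hamilton cycles and their symmetries\<close>

text \<open>
  On side \<open>False\<close> the cycle visits the even positions \<open>0, 2, \<dots>, 2m - 2\<close>, returns along the odd
  positions \<open>2m - 1, \<dots>, 3, 1\<close>, jumps over \<open>0\<close> to \<open>-1\<close> and descends to \<open>2m\<close>. So it ends at the position
  \<open>2m = c True\<close>, where a spoke leads to side \<open>True\<close>; there unit steps \<open>2m, 2 \<sqdot> 2m, \<dots>, p \<sqdot> 2m = 0\<close> reach
  all positions, and a spoke closes the cycle.
\<close>

lemma hamilton_cycle_X: "\<exists>C. hamilton_cycle X C"
proof -
  let ?P = "\<lambda>u v. (u, v) \<in> parcs X"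
  define A where "A = map (\<lambda>j. vtx False (2 * int j)) [0..<m]"
  define B where "B = map (\<lambda>j. vtx False (2 * int m - 1 - 2 * int j)) [0..<m]"
  define D where "D = map (\<lambda>j. vtx False (- 1 - int j)) [0..<p - 2 * m]"
  define E where "E = map (\<lambda>j. vtx True (2 * int m * (int j + 1))) [0..<p]"
  define C where "C = A @ B @ D @ E"
  have succ: "successively ?P (map f [0..<n])"
    if "\<And>j. (f j, f (Suc j)) \<in> parcs X" for f n
    using that by (auto simp: successively_conv_nth)
  have arc: "(vtx s x, vtx s y) \<in> parcs X" if "y - x = d * c s" "d \<in> steps" for s x y d
    using that by (auto simp: arc_iff intro!: bexI[of _ d])
  have len: "length C = 2 * p" using m by (simp add: C_def A_def B_def D_def E_def)
  have ne: "A \<noteq> []" "B \<noteq> []" "D \<noteq> []" "E \<noteq> []" using m p_pos by (auto simp: A_def B_def D_def E_def)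
  have hd_last: "hd (map f [0..<n]) = f 0" "last (map f [0..<n]) = f (n - 1)"
    if "0 < n" for f :: "nat \<Rightarrow> nat" and n
    using that by (simp_all add: hd_map last_map)
  have A_ends: "hd A = vtx False 0" "last A = vtx False (2 * int m - 2)"
    using m by (simp_all add: A_def hd_last algebra_simps)
  have B_ends: "hd B = vtx False (2 * int m - 1)" "last B = vtx False 1"
    using m by (simp_all add: B_def hd_last algebra_simps)
  have "last D = vtx False (- 1 - int (p - 2 * m - 1))" using m by (simp add: D_def hd_last)
  also have "\<dots> = vtx False (2 * int m)" using m by (simp add: vtx_eq_iff)
  finally have D_ends: "hd D = vtx False (- 1)" "last D = vtx False (2 * int m)"
    using m by (simp_all add: D_def hd_last)
  have "last E = vtx True (2 * int m * int p)"
    using p_pos by (simp add: E_def hd_last)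
  then have E_ends: "hd E = vtx True (2 * int m)" "last E = vtx True 0"
    using p_pos by (simp_all add: E_def hd_last vtx_eq_iff)
  have "successively ?P A" unfolding A_def
    by (rule succ, rule arc[of _ _ 2]) (simp_all add: steps_def c_def)
  moreover have "successively ?P B" unfolding B_def
    by (rule succ, rule arc[of _ _ "- 2"]) (simp_all add: steps_def c_def)
  moreover have "successively ?P D" unfolding D_def
    by (rule succ, rule arc[of _ _ "- 1"]) (simp_all add: steps_def c_def)
  moreover have "successively ?P E" unfolding E_def
    by (rule succ, rule arc[of _ _ 1]) (simp_all add: steps_def c_def algebra_simps)
  moreover have "?P (last A) (hd B)"
    unfolding A_ends B_ends by (rule arc[of _ _ 1]) (simp_all add: steps_def c_def)
  moreover have "?P (last B) (hd D)"
    unfolding B_ends D_ends by (rule arc[of _ _ "- 2"]) (simp_all add: steps_def c_def)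
  moreover have "?P (last D) (hd E)"
    unfolding D_ends E_ends by (simp add: arc_iff)
  ultimately have succ_C: "successively ?P C"
    using ne by (simp add: C_def successively_append_iff)
  have closing: "?P (last C) (hd C)"
    using ne A_ends E_ends by (simp add: C_def arc_iff)
  have "v \<in> set C" if "v \<in> pverts X" for v
  proof -
    have "v < 2 * p" using that by (simp add: pverts_X)
    then obtain s x where v: "v = vtx s (int x)" and "x < p" by (rule vtx_cases)
    consider "s" | (even) "\<not> s" "x < 2 * m" "even x" | (odd) "\<not> s" "x < 2 * m" "odd x"
      | (rest) "\<not> s" "2 * m \<le> x"
      using linorder_not_le[of "2 * m" x] by blast
    then show ?thesis
    proof cases
      case 1
      \<comment> \<open>The inverse of \<open>2m\<close> modulo \<open>p\<close> is \<open>-2m\<close>, and \<open>j\<close> solves \<open>2m(j + 1) = x\<close>.\<close>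
      define j where "j = nat ((- (2 * int m) * int x - 1) mod int p)"
      have "j < p" using p_pos by (simp add: j_def nat_less_iff)
      have "int p dvd int j - (- (2 * int m) * int x - 1)"
        using p_pos by (simp add: j_def) (metis mod_eq_dvd_iff mod_mod_trivial)
      then have "int p dvd 2 * int m * (int j - (- (2 * int m) * int x - 1))
          - int x * ((2 * int m)\<^sup>2 + 1)"
        using root by (meson dvd_diff dvd_mult)
      then have "vtx True (2 * int m * (int j + 1)) = v"
        using 1 by (simp add: v vtx_eq_iff algebra_simps power2_eq_square)
      then show ?thesis using \<open>j < p\<close> by (auto simp: C_def E_def)
    next
      case even
      then obtain j where "x = 2 * j" by blast
      then have "v \<in> set A" using even v by (auto simp: A_def)
      then show ?thesis by (simp add: C_def)
    next
      case odd
      then obtain j where "x = 2 * j + 1" by (auto elim: oddE)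
      then have "v = vtx False (2 * int m - 1 - 2 * int (m - 1 - j))" "m - 1 - j < m"
        using odd v by auto
      then have "v \<in> set B" by (auto simp: B_def)
      then show ?thesis by (simp add: C_def)
    next
      case rest
      have "v = vtx False (- 1 - int (p - 1 - x))"
        using \<open>x < p\<close> rest v by (simp add: vtx_eq_iff)
      moreover have "p - 1 - x < p - 2 * m" using rest \<open>x < p\<close> by linarith
      ultimately have "v \<in> set D" by (auto simp: D_def)
      then show ?thesis by (simp add: C_def)
    qed
  qed
  moreover have "set C \<subseteq> pverts X" by (auto simp: C_def A_def B_def D_def E_def)
  ultimately have set_C: "set C = pverts X" by blast
  then have "distinct C" by (intro card_distinct) (simp add: card_pverts_X len)
  moreover have "C \<noteq> []" "length C \<ge> 3" using ne len p_ge by (auto simp: C_def)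
  ultimately show ?thesis
    using successively_imp_cyclically_adjacent[OF succ_C _ closing] set_C
    unfolding hamilton_cycle_def by blast
qed

text \<open>
  The rotation by \<open>2p/k\<close> positions has order \<open>k\<close>, a divisor of \<open>2p\<close>. For even \<open>k\<close> a power of it is the
  rotation by half of the cycle, an involution without fixed vertices. The other case to exclude is
  \<open>k = p\<close>, a rotation by two positions.
\<close>

lemma no_rotational_symmetry:
  assumes C: "hamilton_cycle X C" and k: "symmetric_cycle X C k"
  shows "k = 1"
proof -
  have dist: "distinct C" and set: "set C = pverts X"
    and adj: "\<And>i. i < length C \<Longrightarrow> (C ! i, C ! ((i + 1) mod length C)) \<in> parcs X"
    using C by (auto simp: hamilton_cycle_def)
  have len: "length C = 2 * p" using distinct_card[OF dist] set card_pverts_X by simp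
  obtain \<alpha> where "k > 0" and kp: "k dvd 2 * p" and \<alpha>: "automorphism X \<alpha>"
    and "\<And>i. i < 2 * p \<Longrightarrow> \<alpha> (C ! i) = C ! ((i + 2 * p div k) mod (2 * p))"
    using k by (auto simp: symmetric_cycle_def len)
  then have rot: "\<alpha> (C ! (i mod (2 * p))) = C ! ((i + 2 * p div k) mod (2 * p))" for i
    using p_pos by (simp add: mod_simps)
  have "odd k"
  proof
    assume "even k"
    then obtain j where j: "k = 2 * j" by blast
    then obtain r where r: "p = j * r" using kp by auto
    then have "2 * p div k = r" using j \<open>k > 0\<close> by simp
    have "(\<alpha> ^^ i) (C ! (x mod (2 * p))) = C ! ((x + i * r) mod (2 * p))" for i x
    proof (induction i)
      case (Suc i)
      then show ?case using rot[of "x + i * r"] \<open>2 * p div k = r\<close> by (simp add: algebra_simps)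
    qed simp
    from this[of j] have half: "(\<alpha> ^^ j) (C ! (x mod (2 * p))) = C ! ((x + p) mod (2 * p))" for x
      by (simp add: r)
    have vert: "\<exists>x < 2 * p. v = C ! (x mod (2 * p))" if "v \<in> pverts X" for v
      using that set len by (metis in_set_conv_nth mod_less)
    have "(\<alpha> ^^ j) ((\<alpha> ^^ j) v) = v" if v: "v \<in> pverts X" for v
    proof -
      obtain x where x: "v = C ! (x mod (2 * p))" using vert[OF v] by blast
      then have "(\<alpha> ^^ j) ((\<alpha> ^^ j) v) = C ! ((x + 2 * p) mod (2 * p))"
        by (simp only: half add.assoc flip: mult_2)
      then show ?thesis using x by (simp only: mod_add_self2)
    qed
    then obtain v where v: "v \<in> pverts X" "(\<alpha> ^^ j) v = v"
      using involution_fixes_vertex[OF automorphism_funpow[OF pair_graph_X \<alpha>, of j]] by blast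
    then obtain x where x: "x < 2 * p" "v = C ! (x mod (2 * p))" using vert[of v] by blast
    then have "C ! ((x + p) mod (2 * p)) = C ! x" using v(2) half[of x] by simp
    then have "(x + p) mod (2 * p) = x"
      using dist len p_pos x(1) nth_eq_iff_index_eq[of C "(x + p) mod (2 * p)" x] by simp
    then show False using x(1) p_pos by (cases "x < p") (simp_all add: le_mod_geq)
  qed
  then have "coprime k 2" by simp
  then have "k dvd p" using kp by (simp add: coprime_dvd_mult_right_iff)
  then have "k = 1 \<or> k = p" using prime by (simp add: prime_nat_iff)
  moreover have "k \<noteq> p"
  proof
    assume "k = p"
    then have rot2: "\<alpha> (C ! (i mod (2 * p))) = C ! ((i + 2) mod (2 * p))" for i
      using rot p_pos by simp
    obtain t a b where "a = c t \<or> a = - c t"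
      and aff: "\<And>s x. \<alpha> (vtx s x) = vtx (s \<noteq> t) (a * x + b)"
      using automorphism_X_affine[OF \<alpha>] by metis
    have \<alpha>_side: "odd (\<alpha> v) \<longleftrightarrow> (odd v \<noteq> t)" if v: "v \<in> pverts X" for v
    proof -
      obtain s x where "v = vtx s (int x)" using v by (metis pverts_X vtx_cases)
      then show ?thesis by (simp only: aff odd_vtx)
    qed
    have inV: "C ! (i mod (2 * p)) \<in> pverts X" for i
      unfolding set[symmetric] using p_pos by (intro nth_mem) (simp add: len)
    have side2: "odd (C ! ((i + 2) mod (2 * p))) \<longleftrightarrow> (odd (C ! (i mod (2 * p))) \<noteq> t)" for i
      using \<alpha>_side[OF inV] by (simp only: rot2)
    have side: "odd (C ! ((i + 2 * j) mod (2 * p))) \<longleftrightarrow> (odd (C ! (i mod (2 * p))) \<noteq> (odd j \<and> t))" for i j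
    proof (induction j)
      case (Suc j)
      then show ?case using side2[of "i + 2 * j"] by (simp add: algebra_simps) blast
    qed simp
    have "odd p" using prime p_ge prime_odd_nat[of p] by simp
    \<comment> \<open>After \<open>p\<close> double steps the cycle is back at its start, and an odd number of exchanges would
      have changed the side.\<close>
    then have "\<not> t" using side[of 0 p] by auto
    \<comment> \<open>Vertices two steps apart are on the same side; if this also held for the first two, one side
      would never be visited.\<close>
    have alt: "odd (C ! 1) \<noteq> odd (C ! 0)"
    proof
      assume same: "odd (C ! 1) = odd (C ! 0)"
      have "odd (C ! i) = odd (C ! 0)" if "i < 2 * p" for i
      proof (cases "even i")
        case True
        then show ?thesis using that side[of 0 "i div 2"] \<open>\<not> t\<close> by simp
      next
        case False
        then have "i = 1 + 2 * (i div 2)" by presburger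
        then show ?thesis using that side[of 1 "i div 2"] \<open>\<not> t\<close> p_ge same by simp
      qed
      then have "odd v = odd (C ! 0)" if "v \<in> pverts X" for v
        using that set len by (metis in_set_conv_nth)
      from this[of "vtx True 0"] this[of "vtx False 0"] show False by simp
    qed
    have "(C ! 0, C ! 1) \<in> parcs X" "(C ! 1, C ! 2) \<in> parcs X"
      using adj[of 0] adj[of 1] p_ge len by (simp_all add: numeral_2_eq_2)
    moreover have "odd (C ! 2) = odd (C ! 0)" using side[of 0 1] \<open>\<not> t\<close> p_ge
      by (simp add: numeral_2_eq_2)
    moreover obtain s x s' y s'' z where "C ! 0 = vtx s x" "C ! 1 = vtx s' y" "C ! 2 = vtx s'' z"
      using calculation(1,2) by (metis arc_cases)
    ultimately have "s' \<noteq> s" "s'' = s" "int p dvd x - y" "int p dvd y - z"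
      using alt by (auto simp: arc_iff)
    then have "C ! 0 = C ! 2"
      using dvd_add[of "int p" "x - y" "y - z"] \<open>C ! 0 = _\<close> \<open>C ! 2 = _\<close> by (simp add: vtx_eq_iff)
    then show False using dist len p_ge by (simp add: nth_eq_iff_index_eq)
  qed
  ultimately show ?thesis by blast
qed

lemma hamilton_compression_X: "hamilton_compression X = 1"
proof -
  interpret pair_graph X by (rule pair_graph_X)
  have wf: "pair_wf_digraph X" by unfold_locales
  have "compression_factor X C = 1" if "hamilton_cycle X C" for C
  proof -
    have "{k. symmetric_cycle X C k} = {1}"
      using no_rotational_symmetry[OF that] symmetric_cycle_finite_nonempty(2)[OF wf that] by blast
    then show ?thesis by (simp add: compression_factor_def)
  qed
  then have "{compression_factor X C | C. hamilton_cycle X C} = {1}"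
    using hamilton_cycle_X by force
  then show ?thesis using hamilton_cycle_X by (simp add: hamilton_compression_def)
qed

end

section \<open>Infinitely many parameters\<close>

text \<open>
  Reduce a square root of \<open>-1\<close> modulo \<open>p\<close> and change its sign if it is odd.
\<close>

lemma twisted_square_prism_exists:
  assumes "prime p" "p \<ge> 7" and a: "int p dvd a\<^sup>2 + 1"
  shows "\<exists>m. twisted_square_prism p m"
proof -
  have "odd p" using prime_odd_nat[OF assms(1)] assms(2) by simp
  have p0: "int p > 0" using assms(2) by simp
  define r where "r = a mod int p"
  define k where "k = (if even r then r else int p - r)"
  have ra: "int p dvd r - a" unfolding r_def by (metis mod_eq_dvd_iff mod_mod_trivial)
  have r2: "int p dvd r\<^sup>2 + 1"
  proof -
    have "int p dvd (r - a) * (r + a) + (a\<^sup>2 + 1)" using ra a by (meson dvd_add dvd_mult2)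
    then show ?thesis by (simp add: algebra_simps power2_eq_square)
  qed
  have "r \<noteq> 0" using r2 assms(2) by auto
  then have r: "0 < r" "r < int p"
    using pos_mod_bound[OF p0, of a] pos_mod_sign[OF p0, of a] unfolding r_def by linarith+
  have "int p dvd (int p - r)\<^sup>2 + 1"
  proof -
    show ?thesis using dvd_add[OF dvd_triv_left r2, of "int p - 2 * r"]
      by (simp add: algebra_simps power2_eq_square)
  qed
  with r r2 \<open>odd p\<close> have k: "0 < k" "k < int p" "even k" "int p dvd k\<^sup>2 + 1"
    by (auto simp: k_def)
  then have "k = 2 * int (nat (k div 2))" by simp
  then obtain m where "k = 2 * int m" ..
  with k assms(1,2) have "twisted_square_prism p m" by unfold_locales auto
  then show ?thesis ..
qed

text \<open>
  As in Euclid's proof for primes congruent to 1 modulo 4: a prime factor of \<open>(n!)\<^sup>2 + 1\<close> exceeds \<open>n\<close>,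
  and \<open>n!\<close> is a square root of \<open>-1\<close> modulo it.
\<close>

lemma infinite_twisted_square_prisms: "infinite {p. \<exists>m. twisted_square_prism p m}"
  unfolding infinite_nat_iff_unbounded
proof
  fix N :: nat
  define a :: nat where "a = fact (max N 7)"
  have "a\<^sup>2 + 1 \<noteq> 1" by (simp add: a_def)
  then obtain p where p: "prime p" "p dvd a\<^sup>2 + 1" using prime_factor_nat by blast
  have "\<not> p dvd a"
  proof
    assume "p dvd a"
    then have "p dvd a\<^sup>2" by (simp add: power2_eq_square)
    then have "p dvd 1" using p(2) by (simp only: dvd_add_right_iff)
    then show False using p(1) by simp
  qed
  then have "p > max N 7" using p(1) by (auto simp: a_def prime_dvd_fact_iff not_le)
  moreover have "int p dvd int (a\<^sup>2 + 1)" using p(2) by (simp only: of_nat_dvd_iff)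
  then have "int p dvd (int a)\<^sup>2 + 1" by (simp only: of_nat_add of_nat_power of_nat_1)
  ultimately show "\<exists>p > N. p \<in> {p. \<exists>m. twisted_square_prism p m}"
    using twisted_square_prism_exists[OF p(1)] by (intro exI[of _ p]) auto
qed

theorem corollary3p2:
  shows "\<exists>\<X> :: nat pair_pre_digraph set.
    infinite \<X> \<and>
    pairwise (\<lambda>X Y. \<not> digraph_iso (with_proj X) (with_proj Y)) \<X> \<and>
    (\<forall>X \<in> \<X>. pair_graph X \<and> vertex_transitive X \<and> \<not> is_cayley_graph X \<and>
       hamilton_compression X = 1)"
proof -
  define P where "P = {p. \<exists>m. twisted_square_prism p m}"
  define M where "M p = (SOME m. twisted_square_prism p m)" for p
  have M: "twisted_square_prism p (M p)" if "p \<in> P" for p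
    using that unfolding P_def M_def by (auto intro: someI_ex)
  define F where "F p = twisted_square_prism.X p (M p)" for p
  have card_F: "card (pverts (F p)) = 2 * p" if "p \<in> P" for p
    using twisted_square_prism.card_pverts_X[OF M[OF that]] by (simp add: F_def)
  have graph: "pair_graph (F p)" if "p \<in> P" for p
    using twisted_square_prism.pair_graph_X[OF M[OF that]] by (simp add: F_def)
  have noniso: "\<not> digraph_iso (with_proj (F p)) (with_proj (F q))" if pq: "p \<in> P" "q \<in> P" "p \<noteq> q" for p q
  proof
    interpret pair_graph "F p" by (rule graph[OF pq(1)])
    have wf: "pair_wf_digraph (F p)" by unfold_locales
    assume "digraph_iso (with_proj (F p)) (with_proj (F q))"
    then have "card (pverts (F p)) = card (pverts (F q))"
      unfolding digraph_iso_pair_iff[OF wf] by (auto dest: bij_betw_same_card)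
    with pq show False by (simp add: card_F)
  qed
  have "inj_on F P"
    by (rule inj_onI) (metis card_F mult_cancel1 zero_neq_numeral)
  then have "infinite (F ` P)"
    using infinite_twisted_square_prisms by (simp add: P_def finite_image_iff)
  moreover have "pairwise (\<lambda>X Y. \<not> digraph_iso (with_proj X) (with_proj Y)) (F ` P)"
    using noniso by (auto simp: pairwise_def)
  moreover have "vertex_transitive (F p) \<and> \<not> is_cayley_graph (F p) \<and> hamilton_compression (F p) = 1"
    if "p \<in> P" for p
    using twisted_square_prism.vertex_transitive_X[OF M[OF that]]
      twisted_square_prism.not_cayley_X[OF M[OF that]]
      twisted_square_prism.hamilton_compression_X[OF M[OF that]] by (simp add: F_def)
  ultimately show ?thesis using graph by (intro exI[of _ "F ` P"]) blast
qed

end
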